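(* Let $K\subseteq\mathbb{R}^n$ be a closed set and $h:\mathbb{R}^n\to\mathbb{R}\cup\{\pm\infty\}$ a proper lower semicontinuous function such that $K\subseteq\operatorname{dom}h$. Suppose that $\overline{x}\in\operatorname{argmin}_K h$, that $K$ is star-shaped at $\overline{x}$, and that $h$ is strongly star quasiconvex on $K$ with modulus $\gamma>0$. Take $\beta'>0$ and a sequence of positive numbers $\{\beta_k\}_{k\ge0}$ such that $0<\beta'\le\beta_k$ for all $k\ge0$. Then the sequence $\{x^k\}$ generated by the proximal point algorithm (described in the context) is a minimizing sequence of $h$ on $K$ and converges linearly to the unique solution $\overline{x}=\operatorname{argmin}_K h$ with rate of at least $$\frac{1}{1+\beta'\gamma}\in\,]0,1[.$$
   Context: $h$ is proper if $\operatorname{dom}h:=\{x: h(x)<+\infty\}\neq\emptyset$ and $h>-\infty$ everywhere. $\operatorname{argmin}_K h$ is the set of minimizers of $h$ over $K$. $K$ is star-shaped at $\overline{x}\in K$ if $[\overline{x},x]\subseteq K$ for every $x\in K$ ($K$ need not be convex). $h$ is strongly star quasiconvex on $K$ with modulus $\gamma>0$ if, with $\overline{x}\in\operatorname{argmin}_K h$ (then necessarily unique), for every $y\in K$ and $\lambda\in[0,1]$, $$h(\lambda\overline{x}+(1-\lambda)y)\le h(y)-\lambda(1-\lambda)\frac{\gamma}{2}\|y-\overline{x}\|^2.$$ For $\beta>0$ and $z\in\mathbb{R}^n$, the (possibly multivalued) proximity operator on $K$ is $$\operatorname{Prox}_{\beta h}(K,z):=\operatorname{argmin}_{y\in K}\Big\{h(y)+\frac{1}{2\beta}\|y-z\|^2\Big\}.$$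 Proximal point algorithm: take $x^0\in K$, $k=0$ and the positive numbers $\{\beta_k\}_{k\ge0}$. At step $k$, take $x^{k+1}\in\operatorname{Prox}_{\beta_k h}(K,x^k)$. If $x^{k+1}=x^k$, stop: $\{x^k\}=\operatorname{argmin}_K h$. Otherwise replace $k$ by $k+1$ and repeat. A minimizing sequence of $h$ on $K$ is a sequence in $K$ with $h(x^k)\to\min_K h$.
   Formalization: The rate 1/(1+β'γ) is proved for squared distances ‖x^k−x̄‖² (so distances contract by its square root); for the distances themselves it fails: h(y)=y²/2 on ℝ, γ=2, β_k=β'=1 gives x^{k+1}=x^k/2, but 1/(1+β'γ)=1/3. *)

theory Defs
  imports "HOL-Analysis.Analysis"
begin

definition effective_dom :: "('a \<Rightarrow> ereal) \<Rightarrow> 'a set" where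
  "effective_dom h = {x. h x < \<infinity>}"

definition proper_fun :: "('a \<Rightarrow> ereal) \<Rightarrow> bool" where
  "proper_fun h \<longleftrightarrow> effective_dom h \<noteq> {} \<and> (\<forall>x. h x > -\<infinity>)"

definition lower_semicontinuous :: "('a::topological_space \<Rightarrow> ereal) \<Rightarrow> bool" where
  "lower_semicontinuous h \<longleftrightarrow> (\<forall>x. h x \<le> Liminf (at x) h)"

definition argmin_on :: "'a set \<Rightarrow> ('a \<Rightarrow> ereal) \<Rightarrow> 'a set" where
  "argmin_on K h = {x. is_arg_min h (\<lambda>y. y \<in> K) x}"

(* The library predicate starlike leaves the centre existentially quantified;
   here the centre is a given point. *)
definition star_shaped_at :: "'a::real_vector set \<Rightarrow> 'a \<Rightarrow> bool" where
  "star_shaped_at K c \<longleftrightarrow> c \<in> K \<and> (\<forall>x\<in>K. closed_segment c x \<subseteq> K)"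

(* The minimizer c is an explicit argument. If K is star-shaped at c and h is finite on K,
   then the inequality forces c to be the only minimizer of h on K, so fixing c loses nothing.
   The ereal subtraction is unambiguous, since a real number is subtracted. *)
definition strongly_star_quasiconvex_on ::
    "'a::real_normed_vector set \<Rightarrow> ('a \<Rightarrow> ereal) \<Rightarrow> real \<Rightarrow> 'a \<Rightarrow> bool" where
  "strongly_star_quasiconvex_on K h \<gamma> c \<longleftrightarrow>
     \<gamma> > 0 \<and> c \<in> argmin_on K h \<and>
     (\<forall>y\<in>K. \<forall>t\<in>{0..1}.
        h (t *\<^sub>R c + (1 - t) *\<^sub>R y)
          \<le> h y - ereal (t * (1 - t) * (\<gamma> / 2) * (norm (y - c))\<^sup>2))"

definition Prox :: "real \<Rightarrow> ('a::real_normed_vector \<Rightarrow> ereal) \<Rightarrow> 'a set \<Rightarrow> 'a \<Rightarrow> 'a set" where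
  "Prox \<beta> h K z = argmin_on K (\<lambda>y. h y + ereal (1 / (2 * \<beta>) * (norm (y - z))\<^sup>2))"

(* A run that stops at step k (because x (Suc k) = x k) is represented by the infinite sequence
   that stays at x k from then on; no proximal step is required after the stop. *)
definition proximal_point_sequence ::
    "'a::real_normed_vector set \<Rightarrow> ('a \<Rightarrow> ereal) \<Rightarrow> (nat \<Rightarrow> real) \<Rightarrow> (nat \<Rightarrow> 'a) \<Rightarrow> bool" where
  "proximal_point_sequence K h \<beta> x \<longleftrightarrow>
     x 0 \<in> K \<and>
     (\<forall>k. if \<exists>j<k. x (Suc j) = x j then x (Suc k) = x k
          else x (Suc k) \<in> Prox (\<beta> k) h K (x k))"

definition minimizing_sequence :: "'a set \<Rightarrow> ('a \<Rightarrow> ereal) \<Rightarrow> (nat \<Rightarrow> 'a) \<Rightarrow> bool" where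
  "minimizing_sequence K h x \<longleftrightarrow>
     (\<forall>k. x k \<in> K) \<and> (\<lambda>k. h (x k)) \<longlonglongrightarrow> (INF y\<in>K. h y)"

(* The rate is measured on squared distances, as usual for Fejer-type estimates: the distances
   themselves contract by the factor sqrt r. For the proximal point algorithm with r = 1 / (1 + b * g),
   where b is a lower bound of the step sizes and g the modulus, the bound with unsquared distances
   is false: h y = y^2 / 2 on the real line is strongly star quasiconvex with modulus g = 2,
   and b = 1 gives the iteration x (Suc k) = x k / 2, whereas r = 1 / 3. *)
definition converges_linearly ::
    "(nat \<Rightarrow> 'a::metric_space) \<Rightarrow> 'a \<Rightarrow> real \<Rightarrow> bool" where
  "converges_linearly x c r \<longleftrightarrow>
     x \<longlonglongrightarrow> c \<and> r \<in> {0<..<1} \<and> (\<forall>k. (dist (x (Suc k)) c)\<^sup>2 \<le> r * (dist (x k) c)\<^sup>2)"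

end

theory Submission
  imports Defs
begin

text \<open>
  Comparing a proximal point \<open>p\<close> of \<open>z\<close> with the points \<open>t c + (1 - t) p\<close> of the segment towards
  the minimizer \<open>c\<close>, dividing by \<open>t\<close> and letting \<open>t\<close> tend to 0 gives
  \<open>|p - z|\<^sup>2 + (1 + \<beta> \<gamma>) |p - c|\<^sup>2 \<le> |z - c|\<^sup>2\<close>. This is the contraction, and it also shows
  that \<open>z = p\<close> forces \<open>p = c\<close>. Comparing \<open>p\<close> with \<open>c\<close> itself gives
  \<open>h p \<le> h c + |z - c|\<^sup>2 / (2 \<beta>)\<close>, whence convergence of the function values.
\<close>

lemma argmin_on_iff:
  "x \<in> argmin_on K h \<longleftrightarrow> x \<in> K \<and> (\<forall>y\<in>K. h x \<le> h y)"
  by (auto simp: argmin_on_def is_arg_min_def not_less)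

lemma star_shaped_at_combination:
  assumes "star_shaped_at K c" "y \<in> K" "t \<in> {0..1}"
  shows "t *\<^sub>R c + (1 - t) *\<^sub>R y \<in> K"
proof -
  have "t *\<^sub>R c + (1 - t) *\<^sub>R y \<in> closed_segment c y"
    \<comment> \<open>\<open>closed_segment\<close> puts its parameter on the second endpoint, so
      the weight \<open>t\<close> on \<open>c\<close> corresponds to \<open>1 - t\<close>.\<close>
    using assms(3) by (auto simp: closed_segment_def intro!: exI[of _ "1 - t"])
  then show ?thesis
    using assms by (auto simp: star_shaped_at_def)
qed

lemma strongly_star_quasiconvex_onD:
  assumes "strongly_star_quasiconvex_on K h \<gamma> c" "y \<in> K" "t \<in> {0..1}"
  shows "h (t *\<^sub>R c + (1 - t) *\<^sub>R y)
    \<le> h y - ereal (t * (1 - t) * (\<gamma> / 2) * (norm (y - c))\<^sup>2)"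
  using assms by (auto simp: strongly_star_quasiconvex_on_def)

text \<open>Stewart's identity. Its negative last term contributes the summand 1 of the factor
  \<open>1 + \<beta> * \<gamma>\<close> in the proximal estimate; quasiconvexity contributes the
  other summand.\<close>

lemma norm_combination_diff_power2:
  fixes c p z :: "'a::real_inner"
  shows "(norm (t *\<^sub>R c + (1 - t) *\<^sub>R p - z))\<^sup>2
    = t * (norm (c - z))\<^sup>2 + (1 - t) * (norm (p - z))\<^sup>2 - t * (1 - t) * (norm (p - c))\<^sup>2"
proof -
  have combination: "(norm (t *\<^sub>R u + (1 - t) *\<^sub>R v))\<^sup>2
      = t * (norm u)\<^sup>2 + (1 - t) * (norm v)\<^sup>2 - t * (1 - t) * (norm (v - u))\<^sup>2" for u v :: 'a
    unfolding power2_norm_eq_inner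
    by (simp add: inner_add_left inner_add_right inner_diff_left inner_diff_right
        inner_commute[of v u] algebra_simps)
  have "t *\<^sub>R c + (1 - t) *\<^sub>R p - z = t *\<^sub>R (c - z) + (1 - t) *\<^sub>R (p - z)"
    by (simp add: algebra_simps)
  then show ?thesis
    using combination[of "c - z" "p - z"] by simp
qed

text \<open>The midpoint between \<open>c\<close> and a second minimizer lies in \<open>K\<close>
  and would have a strictly smaller value. Finiteness of \<open>h\<close> on \<open>K\<close> allows
  the value to be cancelled.\<close>

lemma argmin_on_unique_strongly_star_quasiconvex:
  assumes "strongly_star_quasiconvex_on K h \<gamma> c" "star_shaped_at K c"
    and fin: "\<And>y. y \<in> K \<Longrightarrow> \<bar>h y\<bar> \<noteq> \<infinity>"
  shows "argmin_on K h = {c}"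
proof -
  have c: "c \<in> argmin_on K h" and "\<gamma> > 0"
    using assms(1) by (auto simp: strongly_star_quasiconvex_on_def)
  have "y = c" if y: "y \<in> argmin_on K h" for y
  proof -
    have yK: "y \<in> K" using y by (simp add: argmin_on_iff)
    have "h y \<le> h ((1/2) *\<^sub>R c + (1 - 1/2) *\<^sub>R y)"
      using y star_shaped_at_combination[OF assms(2) yK, of "1/2"] by (simp add: argmin_on_iff)
    also have "\<dots> \<le> h y - ereal (1/2 * (1 - 1/2) * (\<gamma> / 2) * (norm (y - c))\<^sup>2)"
      by (rule strongly_star_quasiconvex_onD[OF assms(1) yK]) simp
    finally have "\<gamma> * (norm (y - c))\<^sup>2 \<le> 0"
      using fin[OF yK] by (cases "h y") auto
    then show ?thesis
      using \<open>\<gamma> > 0\<close> by (simp add: mult_le_0_iff)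
  qed
  then show ?thesis using c by blast
qed

lemma Prox_strongly_star_quasiconvex:
  fixes c p z :: "'a::real_inner"
  assumes "strongly_star_quasiconvex_on K h \<gamma> c" "star_shaped_at K c"
    and fin: "\<And>y. y \<in> K \<Longrightarrow> \<bar>h y\<bar> \<noteq> \<infinity>"
    and "\<beta> > 0" and p: "p \<in> Prox \<beta> h K z"
  shows "(norm (p - z))\<^sup>2 + (1 + \<beta> * \<gamma>) * (norm (p - c))\<^sup>2 \<le> (norm (z - c))\<^sup>2"
proof -
  define A B C where "A = (norm (p - z))\<^sup>2" and "B = (norm (p - c))\<^sup>2" and "C = (norm (c - z))\<^sup>2"
  have pK: "p \<in> K" using p by (simp add: Prox_def argmin_on_iff)
  have *: "A + (1 - t) * (1 + \<beta> * \<gamma>) * B \<le> C" if t: "0 < t" "t < 1" for t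
  proof -
    let ?y = "t *\<^sub>R c + (1 - t) *\<^sub>R p"
    have yK: "?y \<in> K"
      using t by (intro star_shaped_at_combination assms(2) pK) auto
    obtain a where a: "h p = ereal a" using fin[OF pK] by auto
    obtain b where b: "h ?y = ereal b" using fin[OF yK] by auto
    have "a + 1 / (2 * \<beta>) * A \<le> b + 1 / (2 * \<beta>) * (norm (?y - z))\<^sup>2"
      using p yK a b unfolding Prox_def argmin_on_iff A_def by force
    moreover have "h ?y \<le> h p - ereal (t * (1 - t) * (\<gamma> / 2) * B)"
      unfolding B_def using t by (intro strongly_star_quasiconvex_onD[OF assms(1) pK]) simp
    \<comment> \<open>In the sum of the two inequalities \<open>a\<close> and \<open>b\<close>
      cancel, which leaves a relation between squared distances only.\<close>
    ultimately have "1 / (2 * \<beta>) * A + t * (1 - t) * (\<gamma> / 2) * B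
        \<le> 1 / (2 * \<beta>) * (t * C + (1 - t) * A - t * (1 - t) * B)"
      using a b by (simp add: norm_combination_diff_power2 A_def B_def C_def)
    then have "2 * \<beta> * (1 / (2 * \<beta>) * A + t * (1 - t) * (\<gamma> / 2) * B)
        \<le> 2 * \<beta> * (1 / (2 * \<beta>) * (t * C + (1 - t) * A - t * (1 - t) * B))"
      using \<open>\<beta> > 0\<close> by (intro mult_left_mono) auto
    moreover have "2 * \<beta> * (1 / (2 * \<beta>) * A + t * (1 - t) * (\<gamma> / 2) * B)
        = A + t * (1 - t) * \<beta> * \<gamma> * B"
      using \<open>\<beta> > 0\<close> by (simp add: field_simps)
    ultimately have "A + t * (1 - t) * \<beta> * \<gamma> * B \<le> t * C + (1 - t) * A - t * (1 - t) * B"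
      using \<open>\<beta> > 0\<close> by simp
    \<comment> \<open>Since \<open>A - (1 - t) * A = t * A\<close>, every remaining term carries a
      factor \<open>t\<close>, so division by \<open>t\<close> loses nothing to first order.\<close>
    then have "t * (A + (1 - t) * (1 + \<beta> * \<gamma>) * B) \<le> t * C"
      by (simp add: algebra_simps)
    then show ?thesis using t by simp
  qed
  have "((\<lambda>t. A + (1 - t) * (1 + \<beta> * \<gamma>) * B) \<longlongrightarrow> A + (1 - 0) * (1 + \<beta> * \<gamma>) * B) (at_right 0)"
    by (intro tendsto_intros)
  moreover have "eventually (\<lambda>t. A + (1 - t) * (1 + \<beta> * \<gamma>) * B \<le> C) (at_right 0)"
    \<comment> \<open>The witness 1 is the right end of the interval of \<open>t\<close> on which
      \<open>*\<close> holds.\<close>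
    by (auto simp: eventually_at_right_field intro!: exI[of _ 1] *)
  ultimately have "A + (1 - 0) * (1 + \<beta> * \<gamma>) * B \<le> C"
    by (intro tendsto_upperbound) auto
  then show ?thesis
    by (simp add: A_def B_def C_def norm_minus_commute)
qed

lemma proximal_point_sequence_in:
  assumes "proximal_point_sequence K h \<beta> x"
  shows "x k \<in> K"
proof (induction k)
  case 0
  then show ?case using assms by (simp add: proximal_point_sequence_def)
next
  case (Suc k)
  then show ?case
    using assms unfolding proximal_point_sequence_def Prox_def argmin_on_iff by metis
qed

text \<open>The first repetition comes from a genuine proximal step, so the repeated point is a
  fixed point of \<open>Prox\<close> and equals \<open>c\<close>; from then on the sequence is
  constant.\<close>

lemma proximal_point_sequence_stopped:
  assumes x: "proximal_point_sequence K h \<beta> x"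
    and fixp: "\<And>k z. z \<in> Prox (\<beta> k) h K z \<Longrightarrow> z = c"
    and "j < k" "x (Suc j) = x j"
  shows "x k = c"
  using assms(3,4)
proof (induction k arbitrary: j)
  case (Suc k)
  show ?case
  proof (cases "\<exists>i<k. x (Suc i) = x i")
    case True
    then have "x (Suc k) = x k"
      using x by (auto simp: proximal_point_sequence_def)
    then show ?thesis using True Suc.IH by auto
  next
    case False
    then have "x (Suc k) \<in> Prox (\<beta> k) h K (x k)"
      using x unfolding proximal_point_sequence_def by metis
    \<comment> \<open>Without a repetition before \<open>k\<close>, the given index \<open>j\<close>
      must be \<open>k\<close> itself.\<close>
    moreover have "x (Suc k) = x k"
      using False Suc.prems less_antisym by blast
    ultimately show ?thesis using fixp by metis
  qed
qed simp

text \<open>After a stop no proximal step is required. This split reduces each one-step estimate to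
  a genuine step or to the constant tail at \<open>c\<close>, where it is immediate.\<close>

lemma proximal_point_sequence_cases:
  assumes x: "proximal_point_sequence K h \<beta> x"
    and fixp: "\<And>k z. z \<in> Prox (\<beta> k) h K z \<Longrightarrow> z = c"
  obtains "x (Suc k) \<in> Prox (\<beta> k) h K (x k)" | "x k = c" "x (Suc k) = c"
proof (cases "\<exists>j<k. x (Suc j) = x j")
  case True
  then obtain j where j: "j < k" "x (Suc j) = x j" by blast
  have "x k = c" "x (Suc k) = c"
    using j by (auto intro!: proximal_point_sequence_stopped[OF x fixp, where j = j])
  then show ?thesis by (rule that(2))
next
  case False
  then show ?thesis
    using x that(1) unfolding proximal_point_sequence_def by metis
qed

text \<open>Iterating the contraction bounds the squared distances by a geometric sequence, so the
  one-step estimate already implies convergence.\<close>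

lemma converges_linearlyI:
  fixes x :: "nat \<Rightarrow> 'a::metric_space"
  assumes r: "r \<in> {0<..<1}"
    and step: "\<And>k. (dist (x (Suc k)) c)\<^sup>2 \<le> r * (dist (x k) c)\<^sup>2"
  shows "converges_linearly x c r"
proof -
  have le: "(dist (x k) c)\<^sup>2 \<le> r ^ k * (dist (x 0) c)\<^sup>2" for k
  proof (induction k)
    case (Suc k)
    have "(dist (x (Suc k)) c)\<^sup>2 \<le> r * (r ^ k * (dist (x 0) c)\<^sup>2)"
      by (rule order_trans[OF step mult_left_mono[OF Suc.IH]]) (use r in auto)
    then show ?case by simp
  qed simp
  have "(\<lambda>k. r ^ k * (dist (x 0) c)\<^sup>2) \<longlonglongrightarrow> 0"
    using r by (intro tendsto_mult_left_zero LIMSEQ_realpow_zero) auto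
  then have "(\<lambda>k. (dist (x k) c)\<^sup>2) \<longlonglongrightarrow> 0"
    by (rule tendsto_sandwich[OF _ _ tendsto_const, rotated 2])
      (intro always_eventually allI zero_le_power2 le)+
  then have "(\<lambda>k. dist (x k) c) \<longlonglongrightarrow> 0"
    using tendsto_real_sqrt[of "\<lambda>k. (dist (x k) c)\<^sup>2" 0] by simp
  then have "x \<longlonglongrightarrow> c"
    by (rule tendsto_dist_iff[THEN iffD2])
  with r step show ?thesis
    unfolding converges_linearly_def by blast
qed

theorem theorem36:
  fixes K :: "(real ^ 'n) set" and h :: "real ^ 'n \<Rightarrow> ereal"
    and xbar :: "real ^ 'n" and \<gamma> \<beta>' :: real
    and \<beta> :: "nat \<Rightarrow> real" and x :: "nat \<Rightarrow> real ^ 'n"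
  assumes "closed K"
    and "proper_fun h"
    and "lower_semicontinuous h"
    and "K \<subseteq> effective_dom h"
    and "xbar \<in> argmin_on K h"
    and "star_shaped_at K xbar"
    and "\<gamma> > 0"
    and "strongly_star_quasiconvex_on K h \<gamma> xbar"
    and "\<beta>' > 0"
    and "\<And>k. \<beta>' \<le> \<beta> k"
    and "proximal_point_sequence K h \<beta> x"
  shows "minimizing_sequence K h x
    \<and> argmin_on K h = {xbar}
    \<and> 1 / (1 + \<beta>' * \<gamma>) \<in> {0<..<1}
    \<and> converges_linearly x xbar (1 / (1 + \<beta>' * \<gamma>))"
proof -
  have fin: "\<bar>h y\<bar> \<noteq> \<infinity>" if "y \<in> K" for y
    using assms(2,4) that by (auto simp: proper_fun_def effective_dom_def)
  have cK: "xbar \<in> K" and cmin: "\<And>y. y \<in> K \<Longrightarrow> h xbar \<le> h y"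
    using assms(5) by (auto simp: argmin_on_iff)
  have \<beta>: "\<beta> k > 0" for k using assms(9) assms(10)[of k] by simp
  have ineq: "(norm (p - z))\<^sup>2 + (1 + \<beta> k * \<gamma>) * (norm (p - xbar))\<^sup>2 \<le> (norm (z - xbar))\<^sup>2"
    if "p \<in> Prox (\<beta> k) h K z" for p z k
    by (rule Prox_strongly_star_quasiconvex[OF assms(8,6) fin \<beta> that])
  define r where "r = 1 / (1 + \<beta>' * \<gamma>)"
  have pos: "\<beta>' * \<gamma> > 0" using assms(7,9) by simp
  then have r: "r \<in> {0<..<1}" by (simp add: r_def)
  have fixp: "z = xbar" if "z \<in> Prox (\<beta> k) h K z" for k z
  proof -
    have "\<beta> k * \<gamma> * (norm (z - xbar))\<^sup>2 \<le> 0"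
      using ineq[OF that] by (simp add: algebra_simps)
    then show ?thesis using \<beta>[of k] assms(7) by (simp add: mult_le_0_iff)
  qed
  have xK: "x k \<in> K" for k by (rule proximal_point_sequence_in[OF assms(11)])
  have contr: "(dist (x (Suc k)) xbar)\<^sup>2 \<le> r * (dist (x k) xbar)\<^sup>2" for k
  proof (rule proximal_point_sequence_cases[OF assms(11) fixp, where k = k])
    assume p: "x (Suc k) \<in> Prox (\<beta> k) h K (x k)"
    have "(1 + \<beta> k * \<gamma>) * (dist (x (Suc k)) xbar)\<^sup>2 \<le> (dist (x k) xbar)\<^sup>2"
      using ineq[OF p] zero_le_power2[of "norm (x (Suc k) - x k)"] unfolding dist_norm by linarith
    \<comment> \<open>The contraction factor improves with the step size, so the lower bound
      \<open>\<beta>'\<close> yields a rate valid for all \<open>k\<close>.\<close>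
    moreover have "(1 + \<beta>' * \<gamma>) * (dist (x (Suc k)) xbar)\<^sup>2 \<le> (1 + \<beta> k * \<gamma>) * (dist (x (Suc k)) xbar)\<^sup>2"
      using assms(7) assms(10)[of k] by (intro mult_right_mono add_left_mono) auto
    ultimately have "(1 + \<beta>' * \<gamma>) * (dist (x (Suc k)) xbar)\<^sup>2 \<le> (dist (x k) xbar)\<^sup>2"
      by linarith
    then show ?thesis
      using pos by (simp add: r_def pos_le_divide_eq mult.commute)
  qed auto
  have lin: "converges_linearly x xbar r"
    by (intro converges_linearlyI r contr)
  have upper: "h (x (Suc k)) \<le> h xbar + ereal (1 / (2 * \<beta>') * (dist (x k) xbar)\<^sup>2)" for k
  proof (rule proximal_point_sequence_cases[OF assms(11) fixp, where k = k])
    assume p: "x (Suc k) \<in> Prox (\<beta> k) h K (x k)"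
    \<comment> \<open>The quadratic penalty is nonnegative. Its coefficient at \<open>xbar\<close>
      is then bounded through \<open>\<beta>'\<close>, so that it cannot blow up along the
      sequence.\<close>
    have "h (x (Suc k)) \<le> h (x (Suc k)) + ereal (1 / (2 * \<beta> k) * (norm (x (Suc k) - x k))\<^sup>2)"
      using \<beta>[of k] by (intro ereal_le_add_self) auto
    also have "\<dots> \<le> h xbar + ereal (1 / (2 * \<beta> k) * (norm (xbar - x k))\<^sup>2)"
      using p cK unfolding Prox_def argmin_on_iff by auto
    also have "\<dots> \<le> h xbar + ereal (1 / (2 * \<beta>') * (norm (xbar - x k))\<^sup>2)"
      using assms(9) assms(10)[of k] by (intro add_left_mono) (auto intro!: mult_right_mono divide_left_mono)
    finally show ?thesis by (simp add: dist_norm norm_minus_commute)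
  qed auto
  have "(\<lambda>k. dist (x k) xbar) \<longlonglongrightarrow> 0"
    using lin by (simp add: converges_linearly_def tendsto_dist_iff[of x])
  then have "(\<lambda>k. 1 / (2 * \<beta>') * (dist (x k) xbar)\<^sup>2) \<longlonglongrightarrow> 1 / (2 * \<beta>') * 0\<^sup>2"
    by (intro tendsto_intros)
  \<comment> \<open>Finiteness of \<open>h xbar\<close> makes addition of extended reals continuous
    here.\<close>
  then have "(\<lambda>k. h xbar + ereal (1 / (2 * \<beta>') * (dist (x k) xbar)\<^sup>2)) \<longlonglongrightarrow> h xbar + ereal (1 / (2 * \<beta>') * 0\<^sup>2)"
    using fin[OF cK] by (intro tendsto_add_ereal) auto
  then have lim: "(\<lambda>k. h xbar + ereal (1 / (2 * \<beta>') * (dist (x k) xbar)\<^sup>2)) \<longlonglongrightarrow> h xbar"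
    by simp
  have "(\<lambda>k. h (x (Suc k))) \<longlonglongrightarrow> h xbar"
    by (rule tendsto_sandwich[OF _ _ tendsto_const lim]; intro always_eventually allI cmin xK upper)
  moreover have "(INF y\<in>K. h y) = h xbar"
    using cK cmin by (intro antisym INF_lower INF_greatest) auto
  ultimately have "minimizing_sequence K h x"
    \<comment> \<open>The estimate concerns \<open>x (Suc k)\<close>; shifting the index does not
      change the limit.\<close>
    using xK by (simp add: minimizing_sequence_def filterlim_sequentially_Suc[of "\<lambda>k. h (x k)"])
  moreover have "argmin_on K h = {xbar}"
    by (rule argmin_on_unique_strongly_star_quasiconvex[OF assms(8,6) fin])
  ultimately show ?thesis
    using r lin unfolding r_def by (intro conjI)
qed

end
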